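(* Let $\mu$ be a probabilistic frame for $\mathbb{R}^n$ with lower frame bound $A>0$ and let $\nu \in \mathcal{P}_2(\mathbb{R}^n)$. Suppose there exists a transport coupling $\gamma \in \Gamma(\mu,\nu)$ such that $$\lambda := \int_{\mathbb{R}^n\times\mathbb{R}^n} \Vert \mathbf{x}-\mathbf{y}\Vert^2 \, d\gamma(\mathbf{x},\mathbf{y}) < A.$$ Then $\nu$ is a probabilistic frame for $\mathbb{R}^n$ with bounds $(\sqrt{A}-\sqrt{\lambda})^2$ and $M_2(\nu)$.
   Context: $\mathcal{P}(\mathbb{R}^n)$ is the set of Borel probability measures on $\mathbb{R}^n$ and $\Vert\cdot\Vert$ is the Euclidean norm. The second moment of $\mu\in\mathcal{P}(\mathbb{R}^n)$ is $M_2(\mu) := \int_{\mathbb{R}^n}\Vert \mathbf{x}\Vert^2 d\mu(\mathbf{x})$, and $\mathcal{P}_2(\mathbb{R}^n)$ is the set of $\mu \in \mathcal{P}(\mathbb{R}^n)$ with $M_2(\mu)<+\infty$. A measure $\mu\in\mathcal{P}(\mathbb{R}^n)$ is a probabilistic frame for $\mathbb{R}^n$ with (frame) bounds $A$ and $B$, where $0<A\le B<\infty$, if for every $\mathbf{x}\in\mathbb{R}^n$, $A\Vert\mathbf{x}\Vert^2 \le \int_{\mathbb{R}^n} |\langle \mathbf{x},\mathbf{y}\rangle|^2 d\mu(\mathbf{y}) \le B\Vert\mathbf{x}\Vert^2$; $A$ is called a lower and $B$ an upper frame bound (the bounds need not be optimal). It is called a probabilistic frame if such $A,B$ exist. $\Gamma(\mu,\nu)$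 denotes the set of transport couplings of $\mu$ and $\nu$: Borel probability measures $\gamma$ on $\mathbb{R}^n\times\mathbb{R}^n$ with first marginal $\mu$ and second marginal $\nu$. *)

theory Defs
  imports "HOL-Probability.Probability"
begin

text \<open>
  All integrands below are nonnegative, so their integrals are taken as \<open>ennreal\<close>-valued
  integrals: a divergent integral is \<open>\<infinity>\<close>, whereas the Bochner integral would be \<open>0\<close>.
\<close>

definition borel_probs :: "'a::topological_space measure set" where
  "borel_probs = {\<mu>. prob_space \<mu> \<and> sets \<mu> = sets borel}"

definition second_moment :: "(real ^ 'n) measure \<Rightarrow> ennreal" where
  "second_moment \<mu> = (\<integral>\<^sup>+ x. ennreal ((norm x)\<^sup>2) \<partial>\<mu>)"

definition borel_probs2 :: "(real ^ 'n) measure set" where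
  "borel_probs2 = {\<mu> \<in> borel_probs. second_moment \<mu> < \<infinity>}"

definition prob_frame_with_bounds :: "(real ^ 'n) measure \<Rightarrow> real \<Rightarrow> real \<Rightarrow> bool" where
  "prob_frame_with_bounds \<mu> A B \<longleftrightarrow>
     \<mu> \<in> borel_probs \<and> 0 < A \<and> A \<le> B \<and>
     (\<forall>x. ennreal (A * (norm x)\<^sup>2) \<le> (\<integral>\<^sup>+ y. ennreal (\<bar>x \<bullet> y\<bar>\<^sup>2) \<partial>\<mu>) \<and>
          (\<integral>\<^sup>+ y. ennreal (\<bar>x \<bullet> y\<bar>\<^sup>2) \<partial>\<mu>) \<le> ennreal (B * (norm x)\<^sup>2))"

definition prob_frame_with_lower_bound :: "(real ^ 'n) measure \<Rightarrow> real \<Rightarrow> bool" where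
  "prob_frame_with_lower_bound \<mu> A \<longleftrightarrow> (\<exists>B. prob_frame_with_bounds \<mu> A B)"

text \<open>The Borel sigma-algebra on the product space is the product of the Borel sigma-algebras
  (\<open>borel_prod\<close>), so \<open>fst\<close> and \<open>snd\<close> are measurable here.\<close>

definition couplings ::
    "(real ^ 'n) measure \<Rightarrow> (real ^ 'n) measure \<Rightarrow> ((real ^ 'n) \<times> (real ^ 'n)) measure set" where
  "couplings \<mu> \<nu> = {\<gamma> \<in> borel_probs. distr \<gamma> borel fst = \<mu> \<and> distr \<gamma> borel snd = \<nu>}"

end

theory Submission
  imports Defs
begin

text \<open>
  Fix \<open>x\<close>. Under the coupling \<open>\<gamma>\<close> the square roots of the two frame integrals are the
  \<open>L\<^sup>2(\<gamma>)\<close>-norms of the functions \<open>x \<bullet> y\<close> and \<open>x \<bullet> z\<close> of \<open>(y, z)\<close>, so they differ by at most the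
  \<open>L\<^sup>2(\<gamma>)\<close>-norm of \<open>x \<bullet> (y - z)\<close>. By the pointwise Cauchy-Schwarz inequality the latter is at most
  \<open>sqrt lam * norm x\<close>, where \<open>lam\<close> is the transport cost. The frame integral of \<open>\<mu>\<close> has square root
  at least \<open>sqrt A * norm x\<close>, so that of \<open>\<nu>\<close> has square root at least
  \<open>(sqrt A - sqrt lam) * norm x\<close>, and \<open>lam < A\<close> makes this a genuine lower bound. The upper bound
  by the second moment is the pointwise Cauchy-Schwarz inequality once more. The two
  ingredients are \<open>nn_integral_square_triangle\<close> (Minkowski's inequality in \<open>L\<^sup>2\<close>) and
  \<open>nn_integral_inner_square_le\<close>.
\<close>

text \<open>
  Minkowski's inequality in \<open>L\<^sup>2\<close>, for real bounds \<open>p\<close> and \<open>q\<close> on the two norms: the cross term of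
  the expanded square is at most \<open>2 * p * q\<close> by the Cauchy-Schwarz inequality for integrals.
\<close>

lemma nn_integral_square_triangle:
  fixes f g :: "'a \<Rightarrow> real"
  assumes [measurable]: "f \<in> borel_measurable M" "g \<in> borel_measurable M"
    and "0 \<le> p" "0 \<le> q"
    and f: "(\<integral>\<^sup>+ x. ennreal ((f x)\<^sup>2) \<partial>M) \<le> ennreal (p\<^sup>2)"
    and g: "(\<integral>\<^sup>+ x. ennreal ((g x)\<^sup>2) \<partial>M) \<le> ennreal (q\<^sup>2)"
  shows "(\<integral>\<^sup>+ x. ennreal ((f x + g x)\<^sup>2) \<partial>M) \<le> ennreal ((p + q)\<^sup>2)"
proof -
  define c where "c = (\<integral>\<^sup>+ x. ennreal \<bar>f x\<bar> * ennreal \<bar>g x\<bar> \<partial>M)"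
  have "c\<^sup>2 \<le> (\<integral>\<^sup>+ x. (ennreal \<bar>f x\<bar>)\<^sup>2 \<partial>M) * (\<integral>\<^sup>+ x. (ennreal \<bar>g x\<bar>)\<^sup>2 \<partial>M)"
    unfolding c_def by (rule Cauchy_Schwarz_nn_integral) measurable
  also have "\<dots> \<le> ennreal (p\<^sup>2) * ennreal (q\<^sup>2)"
    using f g by (intro mult_mono) (simp_all add: ennreal_power)
  also have "\<dots> = ennreal ((p * q)\<^sup>2)"
    by (simp add: ennreal_mult' power_mult_distrib)
  finally have c2: "c\<^sup>2 \<le> ennreal ((p * q)\<^sup>2)" .
  have c: "c \<le> ennreal (p * q)"
  proof (cases c)
    case (real r)
    with c2 have "r\<^sup>2 \<le> (p * q)\<^sup>2"
      by (simp add: ennreal_power)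
    with real \<open>0 \<le> p\<close> \<open>0 \<le> q\<close> show ?thesis
      by (auto intro!: ennreal_leI intro: power2_le_imp_le)
  next
    case top
    with c2 show ?thesis
      by (simp add: power2_eq_square ennreal_top_mult top_unique)
  qed
  have "(\<integral>\<^sup>+ x. ennreal ((f x + g x)\<^sup>2) \<partial>M)
      \<le> (\<integral>\<^sup>+ x. ennreal ((f x)\<^sup>2) + 2 * (ennreal \<bar>f x\<bar> * ennreal \<bar>g x\<bar>) + ennreal ((g x)\<^sup>2) \<partial>M)"
  proof (rule nn_integral_mono)
    fix x
    have "f x * g x \<le> \<bar>f x\<bar> * \<bar>g x\<bar>"
      by (metis abs_ge_self abs_mult)
    then have "(f x + g x)\<^sup>2 \<le> (f x)\<^sup>2 + 2 * (\<bar>f x\<bar> * \<bar>g x\<bar>) + (g x)\<^sup>2"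
      by (simp add: power2_sum)
    then have "ennreal ((f x + g x)\<^sup>2) \<le> ennreal ((f x)\<^sup>2 + 2 * (\<bar>f x\<bar> * \<bar>g x\<bar>) + (g x)\<^sup>2)"
      by (rule ennreal_leI)
    also have "\<dots> = ennreal ((f x)\<^sup>2) + 2 * (ennreal \<bar>f x\<bar> * ennreal \<bar>g x\<bar>) + ennreal ((g x)\<^sup>2)"
      by (simp add: ennreal_plus ennreal_mult)
    finally show "ennreal ((f x + g x)\<^sup>2) \<le>
      ennreal ((f x)\<^sup>2) + 2 * (ennreal \<bar>f x\<bar> * ennreal \<bar>g x\<bar>) + ennreal ((g x)\<^sup>2)" .
  qed
  also have "\<dots> = (\<integral>\<^sup>+ x. ennreal ((f x)\<^sup>2) \<partial>M) + 2 * c + (\<integral>\<^sup>+ x. ennreal ((g x)\<^sup>2) \<partial>M)"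
    unfolding c_def by (simp add: nn_integral_add nn_integral_cmult)
  also have "\<dots> \<le> ennreal (p\<^sup>2) + 2 * ennreal (p * q) + ennreal (q\<^sup>2)"
    using f g c by (intro add_mono mult_left_mono) auto
  also have "\<dots> = ennreal (p\<^sup>2 + 2 * (p * q) + q\<^sup>2)"
    using \<open>0 \<le> p\<close> \<open>0 \<le> q\<close> by (simp add: ennreal_plus ennreal_mult)
  also have "p\<^sup>2 + 2 * (p * q) + q\<^sup>2 = (p + q)\<^sup>2"
    by (simp add: power2_sum)
  finally show ?thesis .
qed

lemma nn_integral_inner_square_le:
  fixes x :: "'b::euclidean_space"
  assumes [measurable]: "h \<in> borel_measurable M"
    and "(\<integral>\<^sup>+ w. ennreal ((norm (h w))\<^sup>2) \<partial>M) = ennreal m" "0 \<le> m"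
  shows "(\<integral>\<^sup>+ w. ennreal ((x \<bullet> h w)\<^sup>2) \<partial>M) \<le> ennreal (m * (norm x)\<^sup>2)"
proof -
  have "(\<integral>\<^sup>+ w. ennreal ((x \<bullet> h w)\<^sup>2) \<partial>M)
      \<le> (\<integral>\<^sup>+ w. ennreal ((norm x)\<^sup>2) * ennreal ((norm (h w))\<^sup>2) \<partial>M)"
  proof (rule nn_integral_mono)
    fix w
    have "(x \<bullet> h w)\<^sup>2 \<le> (norm x * norm (h w))\<^sup>2"
      by (rule abs_le_square_iff[THEN iffD1]) (simp add: Cauchy_Schwarz_ineq2)
    then show "ennreal ((x \<bullet> h w)\<^sup>2) \<le> ennreal ((norm x)\<^sup>2) * ennreal ((norm (h w))\<^sup>2)"
      by (simp add: power_mult_distrib ennreal_leI flip: ennreal_mult)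
  qed
  also have "\<dots> = ennreal ((norm x)\<^sup>2) * ennreal m"
    using assms by (simp add: nn_integral_cmult)
  also have "\<dots> = ennreal (m * (norm x)\<^sup>2)"
    using \<open>0 \<le> m\<close> by (simp add: mult.commute flip: ennreal_mult)
  finally show ?thesis .
qed

theorem proposition1p2:
  fixes \<mu> \<nu> :: "(real ^ 'n) measure"
    and \<gamma> :: "((real ^ 'n) \<times> (real ^ 'n)) measure"
    and A :: real and lam :: ennreal
  assumes "A > 0"
    and "prob_frame_with_lower_bound \<mu> A"
    and "\<nu> \<in> borel_probs2"
    and "\<gamma> \<in> couplings \<mu> \<nu>"
    and "lam = (\<integral>\<^sup>+ (x, y). ennreal ((norm (x - y))\<^sup>2) \<partial>\<gamma>)"
    and "lam < ennreal A"
  shows "prob_frame_with_bounds \<nu>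
           ((sqrt A - sqrt (enn2real lam))\<^sup>2) (enn2real (second_moment \<nu>))"
proof -
  define l where "l = enn2real lam"
  define m where "m = enn2real (second_moment \<nu>)"
  have [simp]: "0 \<le> l" "0 \<le> m"
    by (simp_all add: l_def m_def)
  have lam: "lam = ennreal l"
    using assms(6) by (auto simp: l_def dest: order.strict_trans[OF _ ennreal_less_top])
  have cost: "(\<integral>\<^sup>+ w. ennreal ((norm (fst w - snd w))\<^sup>2) \<partial>\<gamma>) = ennreal l"
    using assms(5) unfolding lam case_prod_unfold by (rule sym)
  have "l < A"
    using assms(6) by (simp add: lam ennreal_less_iff)
  then have gap: "sqrt l < sqrt A"
    by simp
  have m: "second_moment \<nu> = ennreal m"
    using assms(3) by (simp add: m_def borel_probs2_def)
  have \<nu>: "\<nu> \<in> borel_probs"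
    using assms(3) by (simp add: borel_probs2_def)
  then have [measurable_cong]: "sets \<nu> = sets borel"
    by (simp add: borel_probs_def)
  have \<gamma>[measurable_cong]: "sets \<gamma> = sets borel"
    and \<mu>_distr: "\<mu> = distr \<gamma> borel fst" and \<nu>_distr: "\<nu> = distr \<gamma> borel snd"
    using assms(4) by (auto simp: couplings_def borel_probs_def)
  have [measurable]: "fst \<in> \<gamma> \<rightarrow>\<^sub>M (borel :: (real ^ 'n) measure)"
      "snd \<in> \<gamma> \<rightarrow>\<^sub>M (borel :: (real ^ 'n) measure)"
    using \<gamma> by (simp_all add: measurable_cong_sets[OF \<gamma> refl] borel_measurable_continuous_onI
        continuous_on_fst continuous_on_snd continuous_on_id)

  have upper: "(\<integral>\<^sup>+ y. ennreal (\<bar>x \<bullet> y\<bar>\<^sup>2) \<partial>\<nu>) \<le> ennreal (m * (norm x)\<^sup>2)" for x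
    using nn_integral_inner_square_le[of "\<lambda>y. y" \<nu> m x] m by (simp add: second_moment_def)

  have lower: "ennreal ((sqrt A - sqrt l)\<^sup>2 * (norm x)\<^sup>2) \<le> (\<integral>\<^sup>+ y. ennreal (\<bar>x \<bullet> y\<bar>\<^sup>2) \<partial>\<nu>)" for x
  proof -
    obtain b where "0 \<le> b" and b: "(\<integral>\<^sup>+ y. ennreal (\<bar>x \<bullet> y\<bar>\<^sup>2) \<partial>\<nu>) = ennreal b"
      using upper[of x]
      by (cases "\<integral>\<^sup>+ y. ennreal (\<bar>x \<bullet> y\<bar>\<^sup>2) \<partial>\<nu>" rule: ennreal_cases) (auto simp: top_unique)
    have "ennreal (A * (norm x)\<^sup>2) \<le> (\<integral>\<^sup>+ y. ennreal (\<bar>x \<bullet> y\<bar>\<^sup>2) \<partial>\<mu>)"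
      using assms(2) unfolding prob_frame_with_lower_bound_def prob_frame_with_bounds_def by blast
    also have "\<dots> = (\<integral>\<^sup>+ w. ennreal ((x \<bullet> snd w + x \<bullet> (fst w - snd w))\<^sup>2) \<partial>\<gamma>)"
      unfolding \<mu>_distr by (simp add: nn_integral_distr inner_diff_right)
    also have "\<dots> \<le> ennreal ((sqrt b + sqrt l * norm x)\<^sup>2)"
    proof (rule nn_integral_square_triangle)
      show "(\<integral>\<^sup>+ w. ennreal ((x \<bullet> snd w)\<^sup>2) \<partial>\<gamma>) \<le> ennreal ((sqrt b)\<^sup>2)"
        using b \<open>0 \<le> b\<close> unfolding \<nu>_distr by (simp add: nn_integral_distr)
      show "(\<integral>\<^sup>+ w. ennreal ((x \<bullet> (fst w - snd w))\<^sup>2) \<partial>\<gamma>) \<le> ennreal ((sqrt l * norm x)\<^sup>2)"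
        using nn_integral_inner_square_le[of "\<lambda>w. fst w - snd w" \<gamma> l x] cost
        by (simp add: power_mult_distrib)
    qed (use \<open>0 \<le> b\<close> in auto)
    finally have "A * (norm x)\<^sup>2 \<le> (sqrt b + sqrt l * norm x)\<^sup>2"
      by (subst (asm) ennreal_le_iff) auto
    then have "(sqrt A * norm x)\<^sup>2 \<le> (sqrt b + sqrt l * norm x)\<^sup>2"
      using \<open>A > 0\<close> by (simp only: power_mult_distrib real_sqrt_pow2 less_imp_le)
    then have "sqrt A * norm x \<le> sqrt b + sqrt l * norm x"
      by (rule power2_le_imp_le) (simp add: \<open>0 \<le> b\<close>)
    then have "(sqrt A - sqrt l) * norm x \<le> sqrt b"
      by (simp add: left_diff_distrib)
    then have "((sqrt A - sqrt l) * norm x)\<^sup>2 \<le> (sqrt b)\<^sup>2"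
      by (rule power_mono) (use gap in \<open>simp add: less_imp_le\<close>)
    then have "(sqrt A - sqrt l)\<^sup>2 * (norm x)\<^sup>2 \<le> b"
      using \<open>0 \<le> b\<close> by (simp only: power_mult_distrib real_sqrt_pow2)
    then show ?thesis
      unfolding b by (rule ennreal_leI)
  qed

  \<comment> \<open>The bounds are ordered because both hold at a unit vector.\<close>
  obtain e :: "real ^ 'n" where "norm e = 1"
    using vector_choose_size[of 1] by auto
  then have "(sqrt A - sqrt l)\<^sup>2 \<le> m"
    using order_trans[OF lower upper, of e] by simp
  then show ?thesis
    unfolding prob_frame_with_bounds_def l_def[symmetric] m_def[symmetric]
    using \<nu> gap lower upper by auto
qed

end
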